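(* Let $K$ be a $b$-complete idempotent semiring, $X$ a nonempty set, and $V$ a $b$-subsemimodule of $K(X)$. The kernel theorem holds in $V$ if and only if the identity operator $\mathrm{id}\colon V\to V$ is integral.
   Context: An idempotent semigroup is a commutative additive semigroup $(S,\oplus)$ with $x\oplus x = x$ for all $x$; it carries the canonical partial order $x \preccurlyeq y \iff x\oplus y = y$, so $x \oplus y = \sup\{x,y\}$. For $Q\subset S$, $\bigoplus Q$ denotes $\sup Q$ when it exists; "bounded" means bounded above. $S$ is $b$-complete if $\bigoplus Q$ exists for every bounded subset $Q$, including the empty one. An idempotent semiring $K$ is an idempotent semigroup with an associative multiplication $\odot$ distributing over $\oplus$ on both sides, a zero $\mathbf 0$ (neutral for $\oplus$, absorbing for $\odot$) and a unit $\mathbf 1\neq\mathbf 0$. It is $b$-complete if it is $b$-complete as a semigroup and $k\odot\bigoplus Q=\bigoplus (k\odot Q)$, $(\bigoplus Q)\odot k=\bigoplus (Q\odot k)$ for all bounded $Q\subset K$, $k\in K$. An idempotent semimodule over $K$ is an idempotent semigroup $V$ with zero $\mathbf 0$ and a product $k\odot x\in V$ ($k\in K$, $x\in V$) satisfying the usual module axioms. It is $b$-complete if it is $b$-complete as a semigroup and $(\bigoplus Q)\odot x=\bigoplus(Q\odot x)$, $k\odot\bigoplus P=\bigoplus(k\odot P)$ for all bounded $Q\subset K$, $P\subset V$ and all $x\in V$, $k\in K$. A homomorphism $g$ of $b$-complete idempotent semigroups is a $b$-homomorphism if $g(\bigoplus P)=\bigoplus g(P)$ for every bounded $P$. A map $g$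 between $b$-complete semimodules over $K$ is $b$-linear if it is linear ($g(x\oplus y)=g(x)\oplus g(y)$, $g(k\odot x)=k\odot g(x)$) and a $b$-homomorphism. $K(X)$ is the semimodule of all maps $X\to K$ with pointwise operations; it is $b$-complete. A subset of a semimodule is a subsemimodule if it is closed under addition and multiplication by scalars; a subsemimodule of a $b$-complete semimodule is a $b$-subsemimodule if the embedding map is a $b$-homomorphism (the subsemimodule itself being $b$-complete). For $V$ as in the claim and a $b$-complete semimodule $W$ over $K$, a map $A\colon V\to W$ is integral (has an integral representation) if there is a map $k\colon X\to W$ such that for every $f\in V$ the set $\{f(x)\odot k(x)\mid x\in X\}$ is bounded in $W$ and $Af=\bigoplus_{x\in X} f(x)\odot k(x)$. The kernel theorem holds in $V$ if all $b$-linear maps of $V$ to an arbitrary $b$-complete semimodule over $K$ have an integral representation. *)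

theory Defs
  imports "HOL-Algebra.Module" "HOL-Algebra.Lattice"
begin

section \<open>Idempotent semigroups\<close>

text \<open>
  All structures are records with an explicit carrier. A semigroup is given by the fields
  \<open>carrier\<close> and \<open>add\<close> of a ring record; the remaining fields are ignored.
\<close>

locale idempotent_semigroup =
  fixes S (structure)
  assumes sg_closed: "\<lbrakk>x \<in> carrier S; y \<in> carrier S\<rbrakk> \<Longrightarrow> x \<oplus> y \<in> carrier S"
    and sg_assoc: "\<lbrakk>x \<in> carrier S; y \<in> carrier S; z \<in> carrier S\<rbrakk> \<Longrightarrow> (x \<oplus> y) \<oplus> z = x \<oplus> (y \<oplus> z)"
    and sg_commute: "\<lbrakk>x \<in> carrier S; y \<in> carrier S\<rbrakk> \<Longrightarrow> x \<oplus> y = y \<oplus> x"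
    and sg_idem: "x \<in> carrier S \<Longrightarrow> x \<oplus> x = x"

definition canonical_order :: "('a, 'm) ring_scheme \<Rightarrow> 'a gorder" where
  "canonical_order S = \<lparr>carrier = carrier S, eq = (=), le = (\<lambda>x y. x \<oplus>\<^bsub>S\<^esub> y = y)\<rparr>"

definition bounded_in :: "('a, 'm) ring_scheme \<Rightarrow> 'a set \<Rightarrow> bool" where
  "bounded_in S Q \<longleftrightarrow> Q \<subseteq> carrier S \<and> Upper (canonical_order S) Q \<noteq> {}"

definition has_bigsum :: "('a, 'm) ring_scheme \<Rightarrow> 'a set \<Rightarrow> bool" where
  "has_bigsum S Q \<longleftrightarrow> (\<exists>s. least (canonical_order S) s (Upper (canonical_order S) Q))"

text \<open>The following term is meaningful only if \<open>has_bigsum S Q\<close> holds.\<close>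

definition bigsum :: "('a, 'm) ring_scheme \<Rightarrow> 'a set \<Rightarrow> 'a" where
  "bigsum S Q = \<Squnion>\<^bsub>canonical_order S\<^esub> Q"

text \<open>
  The empty set is listed separately because an empty carrier contains no upper bound of it:
  thus a b-complete semigroup is nonempty.
\<close>

locale b_complete_semigroup = idempotent_semigroup +
  assumes bigsum_exists: "\<lbrakk>Q \<subseteq> carrier S; Q = {} \<or> bounded_in S Q\<rbrakk> \<Longrightarrow> has_bigsum S Q"

definition b_homomorphism ::
  "('a, 'm) ring_scheme \<Rightarrow> ('b, 'n) ring_scheme \<Rightarrow> ('a \<Rightarrow> 'b) \<Rightarrow> bool" where
  "b_homomorphism S T g \<longleftrightarrow>
     g \<in> carrier S \<rightarrow> carrier T \<and>
     (\<forall>x\<in>carrier S. \<forall>y\<in>carrier S. g (x \<oplus>\<^bsub>S\<^esub> y) = g x \<oplus>\<^bsub>T\<^esub> g y) \<and>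
     (\<forall>P. bounded_in S P \<longrightarrow> g (bigsum S P) = bigsum T (g ` P))"


section \<open>Idempotent semirings and semimodules\<close>

locale idempotent_semiring = semiring K + idempotent_semigroup K for K (structure) +
  assumes one_neq_zero: "\<one> \<noteq> \<zero>"

locale b_complete_semiring = idempotent_semiring K + b_complete_semigroup K for K (structure) +
  assumes mult_bigsum_left:
      "\<lbrakk>k \<in> carrier K; bounded_in K Q\<rbrakk> \<Longrightarrow> k \<otimes> bigsum K Q = bigsum K ((\<lambda>q. k \<otimes> q) ` Q)"
    and mult_bigsum_right:
      "\<lbrakk>k \<in> carrier K; bounded_in K Q\<rbrakk> \<Longrightarrow> bigsum K Q \<otimes> k = bigsum K ((\<lambda>q. q \<otimes> k) ` Q)"

text \<open>Semimodules reuse the record of modules, whose fields \<open>mult\<close> and \<open>one\<close> are ignored.\<close>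

locale idempotent_semimodule =
  K?: idempotent_semiring K + M?: abelian_monoid M + M?: idempotent_semigroup M
  for K (structure) and M (structure) +
  assumes smult_closed: "\<lbrakk>k \<in> carrier K; x \<in> carrier M\<rbrakk> \<Longrightarrow> k \<odot>\<^bsub>M\<^esub> x \<in> carrier M"
    and smult_assoc:
      "\<lbrakk>k \<in> carrier K; l \<in> carrier K; x \<in> carrier M\<rbrakk> \<Longrightarrow>
        (k \<otimes>\<^bsub>K\<^esub> l) \<odot>\<^bsub>M\<^esub> x = k \<odot>\<^bsub>M\<^esub> (l \<odot>\<^bsub>M\<^esub> x)"
    and smult_l_distr:
      "\<lbrakk>k \<in> carrier K; l \<in> carrier K; x \<in> carrier M\<rbrakk> \<Longrightarrow>
        (k \<oplus>\<^bsub>K\<^esub> l) \<odot>\<^bsub>M\<^esub> x = k \<odot>\<^bsub>M\<^esub> x \<oplus>\<^bsub>M\<^esub> l \<odot>\<^bsub>M\<^esub> x"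
    and smult_r_distr:
      "\<lbrakk>k \<in> carrier K; x \<in> carrier M; y \<in> carrier M\<rbrakk> \<Longrightarrow>
        k \<odot>\<^bsub>M\<^esub> (x \<oplus>\<^bsub>M\<^esub> y) = k \<odot>\<^bsub>M\<^esub> x \<oplus>\<^bsub>M\<^esub> k \<odot>\<^bsub>M\<^esub> y"
    and smult_one: "x \<in> carrier M \<Longrightarrow> \<one>\<^bsub>K\<^esub> \<odot>\<^bsub>M\<^esub> x = x"
    and smult_l_null: "x \<in> carrier M \<Longrightarrow> \<zero>\<^bsub>K\<^esub> \<odot>\<^bsub>M\<^esub> x = \<zero>\<^bsub>M\<^esub>"
    and smult_r_null: "k \<in> carrier K \<Longrightarrow> k \<odot>\<^bsub>M\<^esub> \<zero>\<^bsub>M\<^esub> = \<zero>\<^bsub>M\<^esub>"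

locale b_complete_semimodule =
  idempotent_semimodule K M + M?: b_complete_semigroup M for K (structure) and M (structure) +
  assumes bigsum_smult:
      "\<lbrakk>bounded_in K Q; x \<in> carrier M\<rbrakk> \<Longrightarrow>
        bigsum K Q \<odot>\<^bsub>M\<^esub> x = bigsum M ((\<lambda>q. q \<odot>\<^bsub>M\<^esub> x) ` Q)"
    and smult_bigsum:
      "\<lbrakk>k \<in> carrier K; bounded_in M P\<rbrakk> \<Longrightarrow>
        k \<odot>\<^bsub>M\<^esub> bigsum M P = bigsum M ((\<lambda>p. k \<odot>\<^bsub>M\<^esub> p) ` P)"

definition b_linear ::
  "('k, 'm) ring_scheme \<Rightarrow> ('k, 'v, 'n) module_scheme \<Rightarrow> ('k, 'w, 'p) module_scheme
    \<Rightarrow> ('v \<Rightarrow> 'w) \<Rightarrow> bool" where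
  "b_linear K V W g \<longleftrightarrow>
     b_homomorphism V W g \<and>
     (\<forall>k\<in>carrier K. \<forall>x\<in>carrier V. g (k \<odot>\<^bsub>V\<^esub> x) = k \<odot>\<^bsub>W\<^esub> g x)"


section \<open>Function semimodules and b-subsemimodules\<close>

definition fun_semimodule ::
  "('k, 'm) ring_scheme \<Rightarrow> 'x set \<Rightarrow> ('k, 'x \<Rightarrow> 'k) module" where
  "fun_semimodule K X =
     \<lparr>carrier = X \<rightarrow>\<^sub>E carrier K,
      mult = undefined, one = undefined,
      zero = (\<lambda>x\<in>X. \<zero>\<^bsub>K\<^esub>),
      add = (\<lambda>f g. \<lambda>x\<in>X. f x \<oplus>\<^bsub>K\<^esub> g x),
      smult = (\<lambda>k f. \<lambda>x\<in>X. k \<otimes>\<^bsub>K\<^esub> f x)\<rparr>"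

definition subsemimodule ::
  "('k, 'm) ring_scheme \<Rightarrow> ('k, 'v, 'n) module_scheme \<Rightarrow> 'v set \<Rightarrow> bool" where
  "subsemimodule K M V \<longleftrightarrow>
     V \<subseteq> carrier M \<and>
     (\<forall>x\<in>V. \<forall>y\<in>V. x \<oplus>\<^bsub>M\<^esub> y \<in> V) \<and>
     (\<forall>k\<in>carrier K. \<forall>x\<in>V. k \<odot>\<^bsub>M\<^esub> x \<in> V)"

text \<open>
  In \<open>M\<lparr>carrier := V\<rparr>\<close> boundedness and suprema are taken within \<open>V\<close>. Membership of
  \<open>\<zero>\<^bsub>M\<^esub>\<close> in \<open>V\<close> follows by applying the last two conditions to the empty set.
\<close>

definition b_subsemimodule ::
  "('k, 'm) ring_scheme \<Rightarrow> ('k, 'v, 'n) module_scheme \<Rightarrow> 'v set \<Rightarrow> bool" where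
  "b_subsemimodule K M V \<longleftrightarrow>
     subsemimodule K M V \<and>
     b_complete_semigroup (M\<lparr>carrier := V\<rparr>) \<and>
     b_homomorphism (M\<lparr>carrier := V\<rparr>) M (\<lambda>f. f)"


section \<open>Integral operators and the kernel theorem\<close>

definition integral_operator ::
  "('k, 'm) ring_scheme \<Rightarrow> 'x set \<Rightarrow> ('x \<Rightarrow> 'k) set \<Rightarrow> ('k, 'w, 'p) module_scheme
    \<Rightarrow> (('x \<Rightarrow> 'k) \<Rightarrow> 'w) \<Rightarrow> bool" where
  "integral_operator K X V W A \<longleftrightarrow>
     A \<in> V \<rightarrow> carrier W \<and>
     (\<exists>k \<in> X \<rightarrow> carrier W. \<forall>f\<in>V.
        bounded_in W {f x \<odot>\<^bsub>W\<^esub> k x | x. x \<in> X} \<and>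
        A f = bigsum W {f x \<odot>\<^bsub>W\<^esub> k x | x. x \<in> X})"

text \<open>
  HOL formulas cannot quantify over types, so the target semimodules \<open>W\<close> of the kernel theorem
  range over all b-complete semimodules with carrier inside a given type \<open>'w\<close>. A statement
  about arbitrary targets uses a type variable for \<open>'w\<close>.
\<close>

definition kernel_theorem ::
  "'w itself \<Rightarrow> ('k, 'm) ring_scheme \<Rightarrow> 'x set \<Rightarrow> ('x \<Rightarrow> 'k) set \<Rightarrow> bool" where
  "kernel_theorem TYPE('w) K X V \<longleftrightarrow>
     (\<forall>(W :: ('k, 'w) module) A.
        b_complete_semimodule K W \<longrightarrow>
        b_linear K ((fun_semimodule K X)\<lparr>carrier := V\<rparr>) W A \<longrightarrow>
        integral_operator K X V W A)"

end

theory Submission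
  imports Defs
begin

text \<open>
  If the identity of \<open>V\<close> is integral with kernel \<open>k\<close>, every \<open>f \<in> V\<close> is the bounded supremum in
  \<open>V\<close> of the multiples \<open>f x \<odot> k x\<close>. A b-linear map \<open>A\<close> commutes with bounded suprema and
  scalars, so \<open>A f\<close> is the supremum of the elements \<open>f x \<odot> A (k x)\<close>; that is, \<open>A \<circ> k\<close> is a
  kernel of \<open>A\<close> (lemma \<open>b_linear_integral\<close>). Conversely, the identity is itself a b-linear map
  on \<open>V\<close>, so the kernel theorem applies to it as soon as \<open>V\<close> is an admissible target, that is, a
  b-complete semimodule.

  The latter is the only point that needs work. In the semimodule of all functions suprema are
  computed pointwise, hence it inherits infinite distributivity from \<open>K\<close>
  (\<open>fun_semimodule_b_complete\<close>). It passes to \<open>V\<close> because suprema taken within \<open>V\<close> agree with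
  those taken in the whole function space (\<open>b_subsemimodule_b_complete\<close>).
\<close>

section \<open>Suprema for the canonical order\<close>

text \<open>
  Suprema expressed by the addition alone; for sets inside the carrier this is \<open>least\<close> of
  \<open>Upper\<close> in the canonical order.
\<close>

definition is_sum :: "('a, 'm) ring_scheme \<Rightarrow> 'a set \<Rightarrow> 'a \<Rightarrow> bool" where
  "is_sum S Q s \<longleftrightarrow> s \<in> carrier S \<and> (\<forall>q\<in>Q. q \<oplus>\<^bsub>S\<^esub> s = s) \<and>
     (\<forall>u\<in>carrier S. (\<forall>q\<in>Q. q \<oplus>\<^bsub>S\<^esub> u = u) \<longrightarrow> s \<oplus>\<^bsub>S\<^esub> u = u)"

lemma is_sumI:
  assumes "s \<in> carrier S" "\<And>q. q \<in> Q \<Longrightarrow> q \<oplus>\<^bsub>S\<^esub> s = s"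
    "\<And>u. \<lbrakk>u \<in> carrier S; \<And>q. q \<in> Q \<Longrightarrow> q \<oplus>\<^bsub>S\<^esub> u = u\<rbrakk> \<Longrightarrow> s \<oplus>\<^bsub>S\<^esub> u = u"
  shows "is_sum S Q s"
  using assms unfolding is_sum_def by blast

lemma least_Upper_iff_is_sum:
  assumes "Q \<subseteq> carrier S"
  shows "least (canonical_order S) s (Upper (canonical_order S) Q) \<longleftrightarrow> is_sum S Q s"
proof -
  have "Upper (canonical_order S) Q = {u \<in> carrier S. \<forall>q\<in>Q. q \<oplus>\<^bsub>S\<^esub> u = u}"
    using assms by (auto simp: Upper_def canonical_order_def)
  then show ?thesis by (auto simp: least_def is_sum_def canonical_order_def)
qed

lemma bounded_in_iff:
  "bounded_in S Q \<longleftrightarrow> Q \<subseteq> carrier S \<and> (\<exists>u\<in>carrier S. \<forall>q\<in>Q. q \<oplus>\<^bsub>S\<^esub> u = u)"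
  unfolding bounded_in_def Upper_def canonical_order_def by auto

lemma bounded_inI:
  assumes "Q \<subseteq> carrier S" "u \<in> carrier S" "\<And>q. q \<in> Q \<Longrightarrow> q \<oplus>\<^bsub>S\<^esub> u = u"
  shows "bounded_in S Q"
  using assms unfolding bounded_in_iff by blast

lemma (in idempotent_semigroup) bigsum_eqI:
  assumes Q: "Q \<subseteq> carrier S" and s: "is_sum S Q s"
  shows "bigsum S Q = s"
proof -
  have "bigsum S Q = (SOME t. is_sum S Q t)"
    unfolding bigsum_def sup_def least_Upper_iff_is_sum[OF Q] ..
  also have "\<dots> = s"
  proof (rule some_equality)
    fix t assume "is_sum S Q t"
    with s have "t \<oplus> s = s" "s \<oplus> t = t" "t \<in> carrier S" "s \<in> carrier S"
      unfolding is_sum_def by blast+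
    then show "t = s" using sg_commute by metis
  qed (fact s)
  finally show ?thesis .
qed

lemma (in b_complete_semigroup) bigsum_is_sum:
  assumes "bounded_in S Q"
  shows "is_sum S Q (bigsum S Q)"
proof -
  have Q: "Q \<subseteq> carrier S" using assms by (simp add: bounded_in_iff)
  have "has_bigsum S Q" using assms Q by (simp add: bigsum_exists)
  then obtain s where "is_sum S Q s"
    unfolding has_bigsum_def least_Upper_iff_is_sum[OF Q] by blast
  then show ?thesis using bigsum_eqI[OF Q] by simp
qed

lemma (in b_complete_semigroup) bigsum_closed:
  "bounded_in S Q \<Longrightarrow> bigsum S Q \<in> carrier S"
  using bigsum_is_sum unfolding is_sum_def by blast

lemma (in b_complete_semigroup) bigsum_upper:
  "\<lbrakk>bounded_in S Q; q \<in> Q\<rbrakk> \<Longrightarrow> q \<oplus> bigsum S Q = bigsum S Q"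
  using bigsum_is_sum unfolding is_sum_def by blast

text \<open>
  The empty set is bounded because b-completeness forces the carrier to be nonempty, so that
  results about bounded sets cover it.
\<close>

lemma (in b_complete_semigroup) bounded_in_empty: "bounded_in S {}"
proof -
  have "has_bigsum S {}" by (simp add: bigsum_exists)
  then obtain s where "is_sum S {} s"
    unfolding has_bigsum_def least_Upper_iff_is_sum[OF empty_subsetI] ..
  then show ?thesis by (auto simp: bounded_in_iff is_sum_def)
qed


section \<open>The semimodule of all functions\<close>

lemma fun_semimodule_simps [simp]:
  "carrier (fun_semimodule K X) = X \<rightarrow>\<^sub>E carrier K"
  "zero (fun_semimodule K X) = (\<lambda>x\<in>X. \<zero>\<^bsub>K\<^esub>)"
  "add (fun_semimodule K X) f g = (\<lambda>x\<in>X. f x \<oplus>\<^bsub>K\<^esub> g x)"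
  "smult (fun_semimodule K X) c f = (\<lambda>x\<in>X. c \<otimes>\<^bsub>K\<^esub> f x)"
  by (simp_all add: fun_semimodule_def)

lemma fun_semimodule_add_eq_iff:
  assumes "u \<in> X \<rightarrow>\<^sub>E carrier K"
  shows "f \<oplus>\<^bsub>fun_semimodule K X\<^esub> u = u \<longleftrightarrow> (\<forall>x\<in>X. f x \<oplus>\<^bsub>K\<^esub> u x = u x)"
  using assms by (auto simp: fun_eq_iff PiE_def extensional_def)

lemma fun_bounded_pointwise:
  assumes "bounded_in (fun_semimodule K X) P" "x \<in> X"
  shows "bounded_in K ((\<lambda>f. f x) ` P)"
proof -
  obtain u where P: "P \<subseteq> X \<rightarrow>\<^sub>E carrier K" and u: "u \<in> X \<rightarrow>\<^sub>E carrier K"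
    and ub: "\<forall>f\<in>P. f \<oplus>\<^bsub>fun_semimodule K X\<^esub> u = u"
    using assms(1) unfolding bounded_in_iff by auto
  show ?thesis
  proof (rule bounded_inI)
    show "(\<lambda>f. f x) ` P \<subseteq> carrier K" using P assms(2) by (auto dest: PiE_mem)
    show "u x \<in> carrier K" using u assms(2) by (rule PiE_mem)
    fix q assume "q \<in> (\<lambda>f. f x) ` P"
    then show "q \<oplus>\<^bsub>K\<^esub> u x = u x"
      using ub assms(2) unfolding fun_semimodule_add_eq_iff[OF u] by auto
  qed
qed

lemma fun_semimodule_idempotent_semigroup:
  assumes "idempotent_semigroup K"
  shows "idempotent_semigroup (fun_semimodule K X)"
proof -
  interpret idempotent_semigroup K by fact
  show ?thesis
    by unfold_locales
      (auto simp: fun_eq_iff PiE_def extensional_def Pi_iff sg_closed sg_assoc sg_idem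
        intro: sg_commute)
qed

lemma fun_is_sum_pointwise:
  assumes "b_complete_semigroup K" and bd: "bounded_in (fun_semimodule K X) P"
  shows "is_sum (fun_semimodule K X) P (\<lambda>x\<in>X. bigsum K ((\<lambda>f. f x) ` P))" (is "is_sum ?M P ?s")
proof -
  interpret b_complete_semigroup K by fact
  note pw = fun_bounded_pointwise[OF bd]
  have s: "?s \<in> X \<rightarrow>\<^sub>E carrier K" using bigsum_closed[OF pw] by auto
  show ?thesis
  proof (rule is_sumI)
    show "?s \<in> carrier ?M" using s by simp
  next
    fix f assume f: "f \<in> P"
    have "f x \<oplus>\<^bsub>K\<^esub> ?s x = ?s x" if "x \<in> X" for x
      using bigsum_upper[OF pw[OF that]] f that by simp
    then show "f \<oplus>\<^bsub>?M\<^esub> ?s = ?s" unfolding fun_semimodule_add_eq_iff[OF s] by blast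
  next
    fix u assume "u \<in> carrier ?M" and ub: "\<And>f. f \<in> P \<Longrightarrow> f \<oplus>\<^bsub>?M\<^esub> u = u"
    then have u: "u \<in> X \<rightarrow>\<^sub>E carrier K" by simp
    have "?s x \<oplus>\<^bsub>K\<^esub> u x = u x" if x: "x \<in> X" for x
    proof -
      have "\<forall>q\<in>(\<lambda>f. f x) ` P. q \<oplus>\<^bsub>K\<^esub> u x = u x"
        using ub x unfolding fun_semimodule_add_eq_iff[OF u] by auto
      then show ?thesis
        using bigsum_is_sum[OF pw[OF x]] PiE_mem[OF u x] x unfolding is_sum_def by simp
    qed
    then show "?s \<oplus>\<^bsub>?M\<^esub> u = u" unfolding fun_semimodule_add_eq_iff[OF u] by blast
  qed
qed

lemma fun_bigsum_pointwise:
  assumes "b_complete_semigroup K" and bd: "bounded_in (fun_semimodule K X) P"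
  shows "bigsum (fun_semimodule K X) P = (\<lambda>x\<in>X. bigsum K ((\<lambda>f. f x) ` P))"
  using idempotent_semigroup.bigsum_eqI[OF fun_semimodule_idempotent_semigroup]
    fun_is_sum_pointwise[OF assms] assms
  unfolding b_complete_semigroup_def bounded_in_def by blast

lemma fun_semimodule_b_complete_semigroup:
  assumes "b_complete_semigroup K"
  shows "b_complete_semigroup (fun_semimodule K X)" (is "b_complete_semigroup ?M")
proof -
  interpret b_complete_semigroup K by fact
  interpret M: idempotent_semigroup ?M
    by (rule fun_semimodule_idempotent_semigroup) unfold_locales
  show ?thesis
  proof unfold_locales
    fix P assume P: "P \<subseteq> carrier ?M" and "P = {} \<or> bounded_in ?M P"
    moreover have "bounded_in ?M {}"
      by (rule bounded_inI[where u = "\<lambda>x\<in>X. bigsum K {}"])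
        (auto intro: bigsum_closed bounded_in_empty)
    ultimately have "bounded_in ?M P" by blast
    from fun_is_sum_pointwise[OF assms this] show "has_bigsum ?M P"
      unfolding has_bigsum_def least_Upper_iff_is_sum[OF P] by blast
  qed
qed

text \<open>
  Each product of a supremum is an upper bound of the corresponding set of products, by
  distributivity over finite sums. This makes the set bounded, so its supremum may be computed
  pointwise, and at each point the law reduces to the one in \<open>K\<close>.
\<close>

lemma fun_semimodule_b_complete:
  assumes "b_complete_semiring K"
  shows "b_complete_semimodule K (fun_semimodule K X)" (is "b_complete_semimodule K ?M")
proof -
  interpret K: b_complete_semiring K by fact
  have Kb: "b_complete_semigroup K" by unfold_locales
  interpret M: b_complete_semigroup ?M by (rule fun_semimodule_b_complete_semigroup[OF Kb])
  interpret M: abelian_monoid ?M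
    by (rule abelian_monoidI)
      (auto simp: fun_eq_iff PiE_def extensional_def Pi_iff K.add.m_assoc intro: K.add.m_comm)
  note fun_simps = fun_eq_iff PiE_def extensional_def Pi_iff
  interpret M: idempotent_semimodule K ?M
    by unfold_locales (auto simp: fun_simps K.m_assoc K.l_distr K.r_distr)
  show ?thesis
  proof unfold_locales
    fix Q f assume Q: "bounded_in K Q" and f: "f \<in> carrier ?M"
    let ?Qf = "(\<lambda>q. q \<odot>\<^bsub>?M\<^esub> f) ` Q"
    have bd: "bounded_in ?M ?Qf"
    proof (rule bounded_inI)
      show "?Qf \<subseteq> carrier ?M"
        using Q f
        by (auto simp: bounded_in_iff simp del: fun_semimodule_simps intro: M.smult_closed)
      show "bigsum K Q \<odot>\<^bsub>?M\<^esub> f \<in> carrier ?M"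
        by (rule M.smult_closed[OF K.bigsum_closed[OF Q] f])
      fix h assume "h \<in> ?Qf"
      then obtain q where q: "q \<in> Q" and h: "h = q \<odot>\<^bsub>?M\<^esub> f" by blast
      have "q \<in> carrier K" using Q q by (auto simp: bounded_in_iff)
      then show "h \<oplus>\<^bsub>?M\<^esub> (bigsum K Q \<odot>\<^bsub>?M\<^esub> f) = bigsum K Q \<odot>\<^bsub>?M\<^esub> f"
        unfolding h by (metis M.smult_l_distr K.bigsum_closed[OF Q] K.bigsum_upper[OF Q q] f)
    qed
    have "bigsum K Q \<otimes>\<^bsub>K\<^esub> f x = bigsum K ((\<lambda>h. h x) ` ?Qf)" if x: "x \<in> X" for x
    proof -
      have fx: "f x \<in> carrier K" using f x by auto
      have "(\<lambda>h. h x) ` ?Qf = (\<lambda>q. q \<otimes>\<^bsub>K\<^esub> f x) ` Q" using x by (simp add: image_image)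
      then show ?thesis using K.mult_bigsum_right[OF fx Q] by simp
    qed
    then show "bigsum K Q \<odot>\<^bsub>?M\<^esub> f = bigsum ?M ?Qf"
      unfolding fun_bigsum_pointwise[OF Kb bd] by (simp add: fun_eq_iff)
  next
    fix k P assume k: "k \<in> carrier K" and P: "bounded_in ?M P"
    let ?kP = "(\<lambda>f. k \<odot>\<^bsub>?M\<^esub> f) ` P"
    have bd: "bounded_in ?M ?kP"
    proof (rule bounded_inI)
      show "?kP \<subseteq> carrier ?M"
        using P k
        by (auto simp: bounded_in_iff simp del: fun_semimodule_simps intro: M.smult_closed)
      show "k \<odot>\<^bsub>?M\<^esub> bigsum ?M P \<in> carrier ?M"
        by (rule M.smult_closed[OF k M.bigsum_closed[OF P]])
      fix h assume "h \<in> ?kP"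
      then obtain f where f: "f \<in> P" and h: "h = k \<odot>\<^bsub>?M\<^esub> f" by blast
      have "f \<in> carrier ?M" using P f by (auto simp: bounded_in_iff)
      then show "h \<oplus>\<^bsub>?M\<^esub> (k \<odot>\<^bsub>?M\<^esub> bigsum ?M P) = k \<odot>\<^bsub>?M\<^esub> bigsum ?M P"
        unfolding h by (metis M.smult_r_distr M.bigsum_closed[OF P] M.bigsum_upper[OF P f] k)
    qed
    have "k \<otimes>\<^bsub>K\<^esub> bigsum K ((\<lambda>f. f x) ` P) = bigsum K ((\<lambda>h. h x) ` ?kP)" if x: "x \<in> X" for x
      using K.mult_bigsum_left[OF k fun_bounded_pointwise[OF P x]] x by (simp add: image_image)
    then show "k \<odot>\<^bsub>?M\<^esub> bigsum ?M P = bigsum ?M ?kP"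
      unfolding fun_bigsum_pointwise[OF Kb bd] fun_bigsum_pointwise[OF Kb P]
      by (simp add: fun_eq_iff)
  qed
qed


section \<open>b-subsemimodules\<close>

lemma b_subsemimodule_bigsum:
  assumes "b_subsemimodule K M V" "bounded_in (M\<lparr>carrier := V\<rparr>) P"
  shows "bigsum (M\<lparr>carrier := V\<rparr>) P = bigsum M P"
  using assms unfolding b_subsemimodule_def b_homomorphism_def by simp

lemma bounded_in_superset:
  assumes "V \<subseteq> carrier M" "bounded_in (M\<lparr>carrier := V\<rparr>) P"
  shows "bounded_in M P"
  using assms unfolding bounded_in_iff by auto

text \<open>The zero is the supremum of the empty set, and suprema in \<open>V\<close> are those of \<open>M\<close>.\<close>

lemma b_subsemimodule_zero:
  assumes "b_complete_semimodule K M" "b_subsemimodule K M V"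
  shows "\<zero>\<^bsub>M\<^esub> \<in> V"
proof -
  interpret M: b_complete_semimodule K M by fact
  interpret V: b_complete_semigroup "M\<lparr>carrier := V\<rparr>"
    using assms(2) unfolding b_subsemimodule_def by blast
  have "is_sum M {} \<zero>\<^bsub>M\<^esub>" by (rule is_sumI) auto
  then have "bigsum M {} = \<zero>\<^bsub>M\<^esub>" by (simp add: M.bigsum_eqI)
  then show ?thesis
    using V.bigsum_closed[OF V.bounded_in_empty]
      b_subsemimodule_bigsum[OF assms(2) V.bounded_in_empty] by simp
qed

text \<open>
  Both infinite distributive laws hold in \<open>M\<close>. They transfer because the sets of products are
  bounded within \<open>V\<close>, by the product of the suprema, which lies in \<open>V\<close>.
\<close>

lemma b_subsemimodule_b_complete:
  assumes "b_complete_semigroup K" "b_complete_semimodule K M" "b_subsemimodule K M V"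
  shows "b_complete_semimodule K (M\<lparr>carrier := V\<rparr>)" (is "b_complete_semimodule K ?V")
proof -
  interpret K: b_complete_semigroup K by fact
  interpret M: b_complete_semimodule K M by fact
  interpret V: b_complete_semigroup ?V
    using assms(3) unfolding b_subsemimodule_def by blast
  have sub: "V \<subseteq> carrier M"
    and add: "\<And>x y. \<lbrakk>x \<in> V; y \<in> V\<rbrakk> \<Longrightarrow> x \<oplus>\<^bsub>M\<^esub> y \<in> V"
    and sm: "\<And>k x. \<lbrakk>k \<in> carrier K; x \<in> V\<rbrakk> \<Longrightarrow> k \<odot>\<^bsub>M\<^esub> x \<in> V"
    using assms(3) unfolding b_subsemimodule_def subsemimodule_def by auto
  note inM = subsetD[OF sub]
  interpret V: abelian_monoid ?V
    by (rule abelian_monoidI)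
      (auto simp: add inM b_subsemimodule_zero[OF assms(2,3)] M.add.m_assoc intro: M.add.m_comm)
  interpret V: idempotent_semimodule K ?V
    by unfold_locales
      (auto simp: sm inM M.smult_assoc M.smult_l_distr M.smult_r_distr M.smult_one
        M.smult_l_null M.smult_r_null)
  show ?thesis
  proof unfold_locales
    fix Q x assume Q: "bounded_in K Q" and x: "x \<in> carrier ?V"
    have "bounded_in ?V ((\<lambda>q. q \<odot>\<^bsub>M\<^esub> x) ` Q)"
    proof (rule bounded_inI)
      show "(\<lambda>q. q \<odot>\<^bsub>M\<^esub> x) ` Q \<subseteq> carrier ?V" using Q x sm by (auto simp: bounded_in_iff)
      show "bigsum K Q \<odot>\<^bsub>M\<^esub> x \<in> carrier ?V" using sm[OF K.bigsum_closed[OF Q]] x by simp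
      fix h assume "h \<in> (\<lambda>q. q \<odot>\<^bsub>M\<^esub> x) ` Q"
      then obtain q where q: "q \<in> Q" and h: "h = q \<odot>\<^bsub>M\<^esub> x" by blast
      have "q \<in> carrier K" using Q q by (auto simp: bounded_in_iff)
      then show "h \<oplus>\<^bsub>?V\<^esub> (bigsum K Q \<odot>\<^bsub>M\<^esub> x) = bigsum K Q \<odot>\<^bsub>M\<^esub> x"
        using M.smult_l_distr[of q "bigsum K Q" x] K.bigsum_closed[OF Q]
          K.bigsum_upper[OF Q q] x inM unfolding h by simp
    qed
    from b_subsemimodule_bigsum[OF assms(3) this]
    show "bigsum K Q \<odot>\<^bsub>?V\<^esub> x = bigsum ?V ((\<lambda>q. q \<odot>\<^bsub>?V\<^esub> x) ` Q)"
      using M.bigsum_smult[OF Q] x inM by simp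
  next
    fix k P assume k: "k \<in> carrier K" and P: "bounded_in ?V P"
    have "bounded_in ?V ((\<lambda>p. k \<odot>\<^bsub>M\<^esub> p) ` P)"
    proof (rule bounded_inI)
      show "(\<lambda>p. k \<odot>\<^bsub>M\<^esub> p) ` P \<subseteq> carrier ?V" using P k sm by (auto simp: bounded_in_iff)
      show "k \<odot>\<^bsub>M\<^esub> bigsum ?V P \<in> carrier ?V" using sm[OF k] V.bigsum_closed[OF P] by simp
      fix h assume "h \<in> (\<lambda>p. k \<odot>\<^bsub>M\<^esub> p) ` P"
      then obtain p where p: "p \<in> P" and h: "h = k \<odot>\<^bsub>M\<^esub> p" by blast
      have "p \<in> carrier M" using P p inM by (auto simp: bounded_in_iff)
      then show "h \<oplus>\<^bsub>?V\<^esub> (k \<odot>\<^bsub>M\<^esub> bigsum ?V P) = k \<odot>\<^bsub>M\<^esub> bigsum ?V P"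
        using M.smult_r_distr[OF k, of p "bigsum ?V P"] V.bigsum_closed[OF P]
          V.bigsum_upper[OF P p] inM unfolding h by simp
    qed
    from b_subsemimodule_bigsum[OF assms(3) this]
    show "k \<odot>\<^bsub>?V\<^esub> bigsum ?V P = bigsum ?V ((\<lambda>p. k \<odot>\<^bsub>?V\<^esub> p) ` P)"
      using M.smult_bigsum[OF k bounded_in_superset[OF sub P]]
        b_subsemimodule_bigsum[OF assms(3) P] by simp
  qed
qed

lemma b_linear_identity: "b_linear K V V (\<lambda>f. f)"
  unfolding b_linear_def b_homomorphism_def by simp


section \<open>Integral operators\<close>

text \<open>
  The kernel of \<open>A\<close> is the image under \<open>A\<close> of the kernel of the identity. The set of terms
  \<open>f x \<odot> A (k x)\<close> is bounded in \<open>W\<close> because additivity makes \<open>A\<close> monotone, so that \<open>A f\<close>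
  bounds the image of any set bounded by \<open>f\<close>.
\<close>

lemma b_linear_integral:
  assumes V: "V \<subseteq> carrier (fun_semimodule K X)"
      "b_complete_semigroup ((fun_semimodule K X)\<lparr>carrier := V\<rparr>)"
    and id: "integral_operator K X V ((fun_semimodule K X)\<lparr>carrier := V\<rparr>) (\<lambda>f. f)"
    and A: "b_linear K ((fun_semimodule K X)\<lparr>carrier := V\<rparr>) W A"
  shows "integral_operator K X V W A"
proof -
  let ?V = "(fun_semimodule K X)\<lparr>carrier := V\<rparr>"
  interpret V: b_complete_semigroup ?V by fact
  obtain k where k: "k \<in> X \<rightarrow> V"
    and rep: "\<And>f. f \<in> V \<Longrightarrow> bounded_in ?V {f x \<odot>\<^bsub>?V\<^esub> k x | x. x \<in> X} \<and>
        f = bigsum ?V {f x \<odot>\<^bsub>?V\<^esub> k x | x. x \<in> X}"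
    using id unfolding integral_operator_def by auto
  have AV: "\<And>f. f \<in> V \<Longrightarrow> A f \<in> carrier W"
    and Aadd: "\<And>f g. \<lbrakk>f \<in> V; g \<in> V\<rbrakk> \<Longrightarrow> A (f \<oplus>\<^bsub>?V\<^esub> g) = A f \<oplus>\<^bsub>W\<^esub> A g"
    and Asum: "\<And>P. bounded_in ?V P \<Longrightarrow> A (bigsum ?V P) = bigsum W (A ` P)"
    and Asm: "\<And>c f. \<lbrakk>c \<in> carrier K; f \<in> V\<rbrakk> \<Longrightarrow> A (c \<odot>\<^bsub>?V\<^esub> f) = c \<odot>\<^bsub>W\<^esub> A f"
    using A unfolding b_linear_def b_homomorphism_def by (auto simp del: fun_semimodule_simps)
  have "bounded_in W {f x \<odot>\<^bsub>W\<^esub> A (k x) | x. x \<in> X} \<and>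
      A f = bigsum W {f x \<odot>\<^bsub>W\<^esub> A (k x) | x. x \<in> X}" if f: "f \<in> V" for f
  proof -
    let ?P = "{f x \<odot>\<^bsub>?V\<^esub> k x | x. x \<in> X}"
    have bd: "bounded_in ?V ?P" and f_eq: "bigsum ?V ?P = f" using rep[OF f] by auto
    have P: "?P \<subseteq> V" using bd unfolding bounded_in_iff by simp
    have "A (f x \<odot>\<^bsub>?V\<^esub> k x) = f x \<odot>\<^bsub>W\<^esub> A (k x)" if "x \<in> X" for x
    proof (rule Asm)
      show "f x \<in> carrier K" using f V(1) that by auto
      show "k x \<in> V" using k that by blast
    qed
    then have image: "A ` ?P = {f x \<odot>\<^bsub>W\<^esub> A (k x) | x. x \<in> X}"
      unfolding Setcompr_eq_image image_image by (rule image_cong[OF refl])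
    have "bounded_in W (A ` ?P)"
    proof (rule bounded_inI)
      show "A ` ?P \<subseteq> carrier W" using P AV by blast
      show "A f \<in> carrier W" by (rule AV[OF f])
      fix q assume "q \<in> A ` ?P"
      then obtain p where p: "p \<in> ?P" and q: "q = A p" by blast
      have "p \<oplus>\<^bsub>?V\<^esub> f = f" using V.bigsum_upper[OF bd p] unfolding f_eq .
      then show "q \<oplus>\<^bsub>W\<^esub> A f = A f"
        using Aadd[OF subsetD[OF P p] f] unfolding q by simp
    qed
    then show ?thesis using Asum[OF bd] unfolding f_eq image by blast
  qed
  moreover have "(\<lambda>x. A (k x)) \<in> X \<rightarrow> carrier W" using k AV by auto
  moreover have "A \<in> V \<rightarrow> carrier W" using AV by blast
  ultimately show ?thesis
    unfolding integral_operator_def by (intro conjI bexI[where x = "\<lambda>x. A (k x)"] ballI) auto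
qed

(* 'w is arbitrary. The other instance of the kernel theorem, at the type of the functions on X,
   makes sure that V itself is among the targets, however small 'w may be. *)
theorem mainTheorem7:
  fixes K :: "('k, 'm) ring_scheme" and X :: "'x set" and V :: "('x \<Rightarrow> 'k) set"
  assumes "b_complete_semiring K"
    and "X \<noteq> {}"
    and "b_subsemimodule K (fun_semimodule K X) V"
  shows "kernel_theorem TYPE('x \<Rightarrow> 'k) K X V \<and> kernel_theorem TYPE('w) K X V \<longleftrightarrow>
    integral_operator K X V ((fun_semimodule K X)\<lparr>carrier := V\<rparr>) (\<lambda>f. f)"
proof
  assume "kernel_theorem TYPE('x \<Rightarrow> 'k) K X V \<and> kernel_theorem TYPE('w) K X V"
  then have "kernel_theorem TYPE('x \<Rightarrow> 'k) K X V" ..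
  moreover have "b_complete_semimodule K ((fun_semimodule K X)\<lparr>carrier := V\<rparr>)"
    using b_complete_semiring.axioms(2)[OF assms(1)] fun_semimodule_b_complete[OF assms(1)] assms(3)
    by (rule b_subsemimodule_b_complete)
  ultimately show "integral_operator K X V ((fun_semimodule K X)\<lparr>carrier := V\<rparr>) (\<lambda>f. f)"
    using b_linear_identity unfolding kernel_theorem_def by blast
next
  assume "integral_operator K X V ((fun_semimodule K X)\<lparr>carrier := V\<rparr>) (\<lambda>f. f)"
  moreover have "V \<subseteq> carrier (fun_semimodule K X)"
    "b_complete_semigroup ((fun_semimodule K X)\<lparr>carrier := V\<rparr>)"
    using assms(3) unfolding b_subsemimodule_def subsemimodule_def by blast+
  ultimately show "kernel_theorem TYPE('x \<Rightarrow> 'k) K X V \<and> kernel_theorem TYPE('w) K X V"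
    unfolding kernel_theorem_def by (blast intro: b_linear_integral)
qed

end
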